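(* Let $F$ and $H$ be marked, weighted graphs for which the composition $F\ast H$ is defined, with common vertex $a$. Let $\alpha(a(F)),\beta(a(F)),\alpha(a_m(F))\in R$ be universal weights for $(F,a)$, and let $\alpha(a(H)),\beta(a(H)),\alpha(a_m(H))\in R$ be universal weights for $(H,a)$ (as defined in the context). If neither $F$ nor $H$ contains a marked neighbor of $a$ then $$\begin{aligned} [F\ast H]={}&\alpha(a(F))\cdot(\alpha(a(H))+\beta(a(H)))+\beta(a(F))\cdot(\alpha(a(H))+\beta(a(H))d)\\ &+(\alpha(a(F))d+\beta(a(F)))\cdot\alpha(a_m(H))\\ &+\alpha(a_m(F))\cdot(\alpha(a(H))d+\beta(a(H)))+\alpha(a_m(F))\cdot\alpha(a_m(H)). \end{aligned}$$
   Context: A graph $G=(V(G),E(G))$ is finite and may have loops, multiple edges, and free loops (connected components that contain neither vertices nor edges). A marked graph is a graph each of whose vertices is designated either marked or unmarked. A weighted, marked graph is a marked graph given with functions $\alpha,\beta:V(G)\to R$, where $R$ is a fixed commutative ring containing $A,B,d$, which are treated as independent variables; in particular $d$ and $2-d-d^2$ are not zero divisors in $R$. A vertex $v$ has standard weights if $\alpha(v)=A$ and $\beta(v)=B$. If $V(G)=\{v_1,\dots,v_n\}$, the Boolean adjacency matrix $\mathcal{A}(G)$ is the $n\times n$ matrix over $GF(2)$ with $\mathcal{A}(G)_{ii}=1$ iff $v_i$ is looped and, for $i\neq j$, $\mathcal{A}(G)_{ij}=1$ iff $v_i$ and $v_j$ are adjacent. For $T\subseteq V(G)$, $\mathcal{A}(G)_T$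 is obtained from $\mathcal{A}(G)$ by first changing the $i$th diagonal entry whenever $v_i\in T$, and then removing the $i$th row and column whenever $v_i$ is marked and the (new) $i$th diagonal entry is $0$. The weighted marked-graph bracket polynomial is $$[G]=d^{\phi}\sum_{T\subseteq V(G)}\Big(\prod_{v\notin T}\alpha(v)\Big)\Big(\prod_{t\in T}\beta(t)\Big)d^{\nu(\mathcal{A}(G)_T)},$$ where $\phi$ is the number of free loops of $G$ and $\nu$ is the $GF(2)$-nullity (the empty matrix has nullity $0$). $G-v$ is obtained by removing $v$ and all edges incident on $v$. Composition: a marked, weighted graph $G$ is the composition $F\ast H$ of marked, weighted graphs $F$ and $H$ if: (a) $V(F)\cap V(H)$ consists of a single unlooped, unmarked vertex $a$ that has standard weights in both $F$ and $H$; (b) the elements of $V(G)=V(F)\cup V(H)-\{a\}$ inherit their loops, marks and weights from $F$ and $H$; (c) $E(G)=E(F-a)\cup E(H-a)\cup\{\{v,w\} : \{v,a\}\in E(F)\text{ and }\{a,w\}\in E(H)\}$; (d) $F$ and $H$ do not share any free loop, and the free loops of $G$ are those of $F$ and $H$. Universal weights: for a marked, weighted graph $K$ with an unlooped, unmarked vertex $a$ that has standard weights, elements $\alpha(a(K)),\beta(a(K)),\alpha(a_m(K))\in R$ are universal weights for $(K,a)$ if every composition $K\ast L$ with a marked, weighted graph $L$ in which no neighbor of $a$ is marked satisfies $[K\ast L]=[L']+[L'_m]$, where $L'$ is obtained from $L$ by changing the weights of $a$ to $\alpha(a(K))$ and $\beta(a(K))$, and $L'_m$ is obtained from $L$ by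 marking $a$ and changing its weights to $\alpha(a_m(K))$ and $0$. (Universal weights always exist.) *)

theory Defs
  imports
    Complex_Main
    "HOL-Library.Function_Algebras"
    "HOL-Library.Infinite_Typeclass"
    "HOL-Library.Multiset"
    "HOL-Library.Uprod"
    "HOL-Library.Z2"
begin

(* Edges are unordered pairs with multiplicity; a loop at v is the pair Upair v v.
   Free loops are named objects, so that two graphs may or may not share one.
   The weights are total functions; only their values on verts matter. *)
record ('v, 'l, 'r) mwgraph =
  verts :: "'v set"
  edges :: "'v uprod multiset"
  floops :: "'l set"
  marked :: "'v set"
  alpha :: "'v \<Rightarrow> 'r"
  beta :: "'v \<Rightarrow> 'r"

definition wf_graph :: "('v, 'l, 'r) mwgraph \<Rightarrow> bool" where
  "wf_graph G \<longleftrightarrow>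
     finite (verts G) \<and> finite (floops G) \<and> marked G \<subseteq> verts G \<and>
     (\<forall>e \<in># edges G. set_uprod e \<subseteq> verts G)"

definition looped :: "('v, 'l, 'r) mwgraph \<Rightarrow> 'v \<Rightarrow> bool" where
  "looped G v \<longleftrightarrow> Upair v v \<in># edges G"

definition adjacent :: "('v, 'l, 'r) mwgraph \<Rightarrow> 'v \<Rightarrow> 'v \<Rightarrow> bool" where
  "adjacent G v w \<longleftrightarrow> v \<noteq> w \<and> Upair v w \<in># edges G"

definition del_vertex :: "'v \<Rightarrow> ('v, 'l, 'r) mwgraph \<Rightarrow> ('v, 'l, 'r) mwgraph" where
  "del_vertex a G = G
     \<lparr>verts := verts G - {a},
      edges := filter_mset (\<lambda>e. a \<notin> set_uprod e) (edges G),
      marked := marked G - {a}\<rparr>"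

(* Matrices over GF(2) have their rows and columns indexed by the vertices themselves:
   a matrix is a function of two vertices together with a finite index set. *)
definition adj_matrix :: "('v, 'l, 'r) mwgraph \<Rightarrow> 'v \<Rightarrow> 'v \<Rightarrow> bit" where
  "adj_matrix G v w = of_bool (if v = w then looped G v else adjacent G v w)"

definition toggled_matrix :: "('v, 'l, 'r) mwgraph \<Rightarrow> 'v set \<Rightarrow> 'v \<Rightarrow> 'v \<Rightarrow> bit" where
  "toggled_matrix G T v w = adj_matrix G v w + of_bool (v = w \<and> v \<in> T)"

definition surviving :: "('v, 'l, 'r) mwgraph \<Rightarrow> 'v set \<Rightarrow> 'v set" where
  "surviving G T = {v \<in> verts G. \<not> (v \<in> marked G \<and> toggled_matrix G T v v = 0)}"

definition bit_scale :: "bit \<Rightarrow> ('v \<Rightarrow> bit) \<Rightarrow> 'v \<Rightarrow> bit" where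
  "bit_scale c x = (\<lambda>v. c * x v)"

lemma vector_space_bit_scale: "vector_space bit_scale"
  by unfold_locales (auto simp: bit_scale_def fun_eq_iff algebra_simps)

(* Vectors indexed by S are the functions that vanish outside S. *)
definition kernel_on :: "'v set \<Rightarrow> ('v \<Rightarrow> 'v \<Rightarrow> bit) \<Rightarrow> ('v \<Rightarrow> bit) set" where
  "kernel_on S M = {x. (\<forall>v. v \<notin> S \<longrightarrow> x v = 0) \<and> (\<forall>v\<in>S. (\<Sum>w\<in>S. M v w * x w) = 0)}"

definition nullity_on :: "'v set \<Rightarrow> ('v \<Rightarrow> 'v \<Rightarrow> bit) \<Rightarrow> nat" where
  "nullity_on S M = vector_space.dim bit_scale (kernel_on S M)"

definition bracket :: "'r \<Rightarrow> ('v, 'l, 'r::comm_ring_1) mwgraph \<Rightarrow> 'r" where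
  "bracket d G = d ^ card (floops G) *
     (\<Sum>T\<in>Pow (verts G).
        (\<Prod>v\<in>verts G - T. alpha G v) * (\<Prod>t\<in>T. beta G t) *
        d ^ nullity_on (surviving G T) (toggled_matrix G T))"

definition standard_vertex :: "'r \<Rightarrow> 'r \<Rightarrow> ('v, 'l, 'r) mwgraph \<Rightarrow> 'v \<Rightarrow> bool" where
  "standard_vertex A B G a \<longleftrightarrow>
     a \<in> verts G \<and> \<not> looped G a \<and> a \<notin> marked G \<and> alpha G a = A \<and> beta G a = B"

definition composable ::
  "'r \<Rightarrow> 'r \<Rightarrow> ('v, 'l, 'r) mwgraph \<Rightarrow> ('v, 'l, 'r) mwgraph \<Rightarrow> 'v \<Rightarrow> bool" where
  "composable A B F H a \<longleftrightarrow>
     wf_graph F \<and> wf_graph H \<and>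
     verts F \<inter> verts H = {a} \<and> standard_vertex A B F a \<and> standard_vertex A B H a \<and>
     floops F \<inter> floops H = {}"

(* The edges joining a neighbour of a in F to a neighbour of a in H form a set:
   each occurs once, whatever the multiplicities of the edges at a. *)
definition composition ::
  "'v \<Rightarrow> ('v, 'l, 'r) mwgraph \<Rightarrow> ('v, 'l, 'r) mwgraph \<Rightarrow> ('v, 'l, 'r) mwgraph" where
  "composition a F H =
     \<lparr>verts = (verts F \<union> verts H) - {a},
      edges = edges (del_vertex a F) + edges (del_vertex a H) +
        mset_set {Upair v w | v w. Upair v a \<in># edges F \<and> Upair a w \<in># edges H},
      floops = floops F \<union> floops H,
      marked = (marked F \<union> marked H) - {a},
      alpha = (\<lambda>v. if v \<in> verts F then alpha F v else alpha H v),
      beta = (\<lambda>v. if v \<in> verts F then beta F v else beta H v)\<rparr>"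

definition no_marked_nbr :: "('v, 'l, 'r) mwgraph \<Rightarrow> 'v \<Rightarrow> bool" where
  "no_marked_nbr G a \<longleftrightarrow> (\<forall>v \<in> marked G. \<not> adjacent G a v)"

definition reweight ::
  "'v \<Rightarrow> 'r \<Rightarrow> 'r \<Rightarrow> ('v, 'l, 'r) mwgraph \<Rightarrow> ('v, 'l, 'r) mwgraph" where
  "reweight a x y G = G\<lparr>alpha := (alpha G)(a := x), beta := (beta G)(a := y)\<rparr>"

definition mark :: "'v \<Rightarrow> ('v, 'l, 'r) mwgraph \<Rightarrow> ('v, 'l, 'r) mwgraph" where
  "mark a G = G\<lparr>marked := insert a (marked G)\<rparr>"

(* The types of vertices and of free loops are infinite so that every finite graph L
   has, up to isomorphism, a copy that can be composed with K. *)
definition universal_weights ::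
  "'r \<Rightarrow> 'r \<Rightarrow> 'r \<Rightarrow> ('v::infinite, 'l::infinite, 'r::comm_ring_1) mwgraph \<Rightarrow> 'v
     \<Rightarrow> 'r \<Rightarrow> 'r \<Rightarrow> 'r \<Rightarrow> bool" where
  "universal_weights A B d K a x y x\<^sub>m \<longleftrightarrow>
     wf_graph K \<and> standard_vertex A B K a \<and>
     (\<forall>L. composable A B K L a \<and> no_marked_nbr L a \<longrightarrow>
        bracket d (composition a K L) =
          bracket d (reweight a x y L) + bracket d (mark a (reweight a x\<^sub>m 0 L)))"

end

theory Submission
  imports Defs "HOL-Combinatorics.Transposition"
begin

text \<open>Universality of the weights of \<open>(F, a)\<close> expresses the bracket of the composition of \<open>F\<close>
and \<open>H\<close> through three partial brackets of \<open>H\<close>: those of the sets avoiding \<open>a\<close>, of the sets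
containing \<open>a\<close>, and of \<open>H - a\<close>. Each of them is in turn the bracket of a composition of \<open>H\<close> with
a tiny graph: composing with an isolated vertex \<open>a\<close> deletes \<open>a\<close> from \<open>H\<close>, and composing with a
single edge \<open>ab\<close> renames \<open>a\<close> to \<open>b\<close>, so that the weights \<open>(1, 0)\<close> or \<open>(0, 1)\<close> at \<open>b\<close> isolate one
of the other two partial brackets. Universality of the weights of \<open>(H, a)\<close> then evaluates all
three.\<close>

section \<open>Nullities over GF(2)\<close>

interpretation bitvec: vector_space bit_scale
  by (rule vector_space_bit_scale)

interpretation bitvec_pair: vector_space_pair bit_scale bit_scale
  by unfold_locales

text \<open>An injective linear map carries an independent subset that spans \<open>S\<close> to an
  independent subset that spans the image, without changing its cardinality.\<close>

lemma dim_linear_image_inj: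
  assumes "Vector_Spaces.linear bit_scale bit_scale f" and "inj f"
  shows "bitvec.dim (f ` S) = bitvec.dim S"
proof -
  obtain B where B: "B \<subseteq> S" "bitvec.independent B" "S \<subseteq> bitvec.span B"
      "card B = bitvec.dim S"
    using bitvec.basis_exists by blast
  have "bitvec.independent (f ` B)"
    using bitvec_pair.linear_independent_injective_image[OF assms(1) B(2)] assms(2)
    by (simp add: inj_on_subset)
  moreover have "f ` S \<subseteq> bitvec.span (f ` B)"
    using B(3) bitvec_pair.linear_span_image[OF assms(1)] by blast
  ultimately have "bitvec.dim (f ` S) = card (f ` B)"
    using B(1) by (metis bitvec.basis_card_eq_dim image_mono)
  also have "\<dots> = card B"
    using assms(2) by (meson card_image inj_on_subset subset_UNIV)
  finally show ?thesis
    using B(4) by simp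
qed

text \<open>\<open>kernel_on\<close> reads no entry outside \<open>S\<close>, so matrices that
  differ only in the row and column of a removed vertex may be exchanged.\<close>

lemma nullity_on_cong:
  assumes "\<And>v w. v \<in> S \<Longrightarrow> w \<in> S \<Longrightarrow> M v w = N v w"
  shows "nullity_on S M = nullity_on S N"
proof -
  have "(\<Sum>w\<in>S. M v w * x w) = (\<Sum>w\<in>S. N v w * x w)" if "v \<in> S" for v x
    using assms that by (intro sum.cong) auto
  then show ?thesis
    by (simp add: nullity_on_def kernel_on_def)
qed

text \<open>Precomposition with the inverse of \<open>f\<close> is linear and maps one kernel onto
  the other. Since \<open>f\<close> permutes the whole vertex type, this map is injective on all
  functions and preserves dimensions.\<close>

lemma nullity_on_rename:
  fixes f :: "'v \<Rightarrow> 'v" and M N :: "'v \<Rightarrow> 'v \<Rightarrow> bit"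
  assumes "bij f" and "\<And>v w. v \<in> S \<Longrightarrow> w \<in> S \<Longrightarrow> N (f v) (f w) = M v w"
  shows "nullity_on (f ` S) N = nullity_on S M"
proof -
  let ?g = "inv f"
  let ?h = "\<lambda>x :: 'v \<Rightarrow> bit. x \<circ> ?g"
  have inj: "inj f" and surj: "surj f"
    using assms(1) by (auto simp: bij_def)
  have eq: "(\<Sum>w\<in>f ` S. N (f v) w * x w) = (\<Sum>w\<in>S. M v w * x (f w))" if "v \<in> S" for v x
  proof -
    have "(\<Sum>w\<in>f ` S. N (f v) w * x w) = (\<Sum>w\<in>S. N (f v) (f w) * x (f w))"
      using inj by (subst sum.reindex) (auto intro: inj_on_subset)
    also have "\<dots> = (\<Sum>w\<in>S. M v w * x (f w))"
      using assms(2) that by (intro sum.cong) auto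
    finally show ?thesis .
  qed
  have "kernel_on (f ` S) N = ?h ` kernel_on S M"
  proof (intro equalityI subsetI)
    fix x assume x: "x \<in> kernel_on (f ` S) N"
    \<comment> \<open>The rule \<open>mult_bit_eq_and\<close> is switched off so that products of
      bits keep the form in which \<open>eq\<close> states them.\<close>
    have "x \<circ> f \<in> kernel_on S M"
      using x eq[of _ x] inj
      by (auto simp: kernel_on_def inj_image_mem_iff simp del: mult_bit_eq_and)
    moreover have "x = ?h (x \<circ> f)"
      using surj by (auto simp: fun_eq_iff surj_f_inv_f)
    ultimately show "x \<in> ?h ` kernel_on S M"
      by blast
  next
    fix x assume "x \<in> ?h ` kernel_on S M"
    then obtain y where y: "y \<in> kernel_on S M" "x = ?h y"
      by blast
    \<comment> \<open>This gives the support condition: off the image, \<open>?h y\<close> vanishes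
      because \<open>y\<close> vanishes off \<open>S\<close>.\<close>
    have "?g v \<notin> S" if "v \<notin> f ` S" for v
      using that imageI[of "?g v" S f] by (auto simp: surj_f_inv_f[OF surj])
    then show "x \<in> kernel_on (f ` S) N"
      using y eq[of _ "?h y"] inj by (auto simp: kernel_on_def simp del: mult_bit_eq_and)
  qed
  moreover have "inj ?h"
  proof (rule injI)
    fix x y assume "?h x = ?h y"
    then have "?h x \<circ> f = ?h y \<circ> f"
      by simp
    then show "x = y"
      using inj by (simp add: comp_assoc)
  qed
  moreover have "Vector_Spaces.linear bit_scale bit_scale ?h"
    by (simp add: Vector_Spaces.linear_iff vector_space_bit_scale bit_scale_def fun_eq_iff)
  ultimately show ?thesis
    by (simp add: nullity_on_def dim_linear_image_inj)
qed

section \<open>Explicit nullities of matrices of size at most two\<close>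

lemma dim_bitvec_trivial: "bitvec.dim {0} = 0"
  using bitvec.dim_eq_card[of "{}" "{0}"] by (simp add: bitvec.independent_empty)

lemma dim_bitvec_line:
  assumes "x \<noteq> 0"
  shows "bitvec.dim {0, x} = 1"
  using assms bitvec.dim_eq_card[of "{x}" "{0, x}"]
  by (simp add: bitvec.dependent_single)

lemma nullity_on_empty: "nullity_on {} M = 0"
proof -
  have "kernel_on {} M = {0}"
    by (auto simp: kernel_on_def fun_eq_iff)
  then show ?thesis
    by (simp add: nullity_on_def dim_bitvec_trivial)
qed

lemma nullity_on_singleton:
  fixes a :: 'v
  shows "nullity_on {a} M = (if M a a = 0 then 1 else 0)"
proof -
  have ker: "x \<in> kernel_on {a} M \<longleftrightarrow> (\<forall>v. v \<noteq> a \<longrightarrow> x v = 0) \<and> M a a * x a = 0" for x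
  proof -
    have sum: "(\<Sum>w\<in>{a}. g w) = g a" for g :: "'v \<Rightarrow> bit"
      by simp
    show ?thesis
      unfolding kernel_on_def sum by blast
  qed
  show ?thesis
  proof (cases "M a a = 0")
    case True
    have "kernel_on {a} M = {0, (\<lambda>_. 0)(a := 1)}"
    proof (intro equalityI subsetI)
      fix x assume "x \<in> kernel_on {a} M"
      then show "x \<in> {0, (\<lambda>_. 0)(a := 1)}"
        by (cases "x a") (auto simp: ker fun_eq_iff)
    qed (use True in \<open>auto simp: ker\<close>)
    moreover have "(\<lambda>_. 0)(a := 1 :: bit) \<noteq> 0"
      by (auto simp: fun_eq_iff)
    ultimately show ?thesis
      using True by (simp add: nullity_on_def dim_bitvec_line)
  next
    case False
    then have "kernel_on {a} M = {0}"
      by (auto simp: ker fun_eq_iff)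
    then show ?thesis
      using False by (simp add: nullity_on_def dim_bitvec_trivial)
  qed
qed

text \<open>These are the matrices of a single edge. Each row expresses one coordinate as a diagonal
  entry times the other, so a nonzero kernel vector needs both diagonal entries to be 1.\<close>

lemma nullity_on_pair:
  fixes a b :: 'v
  assumes "a \<noteq> b" and "M a b = 1" and "M b a = 1"
  shows "nullity_on {a, b} M = (if M a a = 1 \<and> M b b = 1 then 1 else 0)"
proof -
  have ker: "x \<in> kernel_on {a, b} M \<longleftrightarrow>
      (\<forall>v. v \<noteq> a \<longrightarrow> v \<noteq> b \<longrightarrow> x v = 0) \<and> x b = M a a * x a \<and> x a = M b b * x b" for x
  proof -
    have "(\<Sum>w\<in>{a, b}. g w) = g a + g b" for g :: "'v \<Rightarrow> bit"
      using assms(1) by (subst sum.insert) auto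
    then have "x \<in> kernel_on {a, b} M \<longleftrightarrow> (\<forall>v. v \<notin> {a, b} \<longrightarrow> x v = 0)
        \<and> M a a * x a + x b = 0 \<and> x a + M b b * x b = 0"
      unfolding kernel_on_def using assms(2,3) by simp
    \<comment> \<open>In characteristic 2 a term crosses the equation without a sign; what remains
      is a check over the values of four bits.\<close>
    then show ?thesis
      by (cases "M a a"; cases "M b b"; cases "x a"; cases "x b") auto
  qed
  show ?thesis
  proof (cases "M a a = 1 \<and> M b b = 1")
    case True
    let ?e = "(\<lambda>_. 0)(a := 1, b := 1 :: bit)"
    have "kernel_on {a, b} M = {0, ?e}"
    proof (intro equalityI subsetI)
      fix x assume "x \<in> kernel_on {a, b} M"
      then have x: "\<And>v. v \<noteq> a \<Longrightarrow> v \<noteq> b \<Longrightarrow> x v = 0" and "x b = M a a * x a"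
        unfolding ker by blast+
      then have "x b = x a"
        using True by simp
      with x have "x = (\<lambda>_. 0)(a := x a, b := x a)"
        by (intro ext) auto
      then show "x \<in> {0, ?e}"
        by (cases "x a") (auto simp: fun_eq_iff)
    next
      fix x assume "x \<in> {0, ?e}"
      then show "x \<in> kernel_on {a, b} M"
        using True assms(1) by (auto simp: ker)
    qed
    moreover have "?e \<noteq> 0"
      by (auto simp: fun_eq_iff)
    ultimately show ?thesis
      using True by (simp add: nullity_on_def dim_bitvec_line)
  next
    case False
    have "kernel_on {a, b} M = {0}"
    proof (intro equalityI subsetI)
      show "x \<in> kernel_on {a, b} M" if "x \<in> {0}" for x
        using that by (simp add: ker)
    next
      fix x assume "x \<in> kernel_on {a, b} M"
      then have x: "\<forall>v. v \<noteq> a \<longrightarrow> v \<noteq> b \<longrightarrow> x v = 0" "x b = M a a * x a" "x a = M b b * x b"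
        unfolding ker by blast+
      \<comment> \<open>A vanishing diagonal entry kills one coordinate, and the other equation then
        kills the remaining one.\<close>
      have "x a = 0 \<and> x b = 0"
      proof (cases "M a a = 0")
        case True
        then have "x b = 0"
          using x(2) by simp
        then show ?thesis
          using x(3) by simp
      next
        case False
        then have "M b b = 0"
          using \<open>\<not> (M a a = 1 \<and> M b b = 1)\<close> by simp
        then have "x a = 0"
          using x(3) by simp
        then show ?thesis
          using x(2) by simp
      qed
      then show "x \<in> {0}"
        using x(1) by (auto simp: fun_eq_iff)
    qed
    then show ?thesis
      using False by (simp add: nullity_on_def dim_bitvec_trivial)
  qed
qed

section \<open>Partial brackets at a vertex\<close>

text \<open>The weight of \<open>a\<close> is left out and the exponent of \<open>d\<close> is a
  parameter, so that all three partial brackets are instances differing only in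
  \<open>\<nu>\<close>.\<close>

definition partial_bracket ::
  "'r \<Rightarrow> ('v, 'l, 'r::comm_ring_1) mwgraph \<Rightarrow> 'v \<Rightarrow> ('v set \<Rightarrow> nat) \<Rightarrow> 'r" where
  "partial_bracket d G a \<nu> = d ^ card (floops G) *
     (\<Sum>T\<in>Pow (verts G - {a}).
        (\<Prod>v\<in>verts G - {a} - T. alpha G v) * (\<Prod>t\<in>T. beta G t) * d ^ \<nu> T)"

definition nullity_at :: "('v, 'l, 'r) mwgraph \<Rightarrow> 'v set \<Rightarrow> nat" where
  "nullity_at G T = nullity_on (surviving G T) (toggled_matrix G T)"

text \<open>The omitted vertices \<open>a\<close> and \<open>b\<close> may differ, as they do when a
  composition renames \<open>a\<close> to \<open>b\<close>.\<close>

lemma partial_bracket_cong: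
  assumes "verts G - {a} = verts H - {b}" and "floops G = floops H"
    and "\<And>v. v \<in> verts G - {a} \<Longrightarrow> alpha G v = alpha H v"
    and "\<And>v. v \<in> verts G - {a} \<Longrightarrow> beta G v = beta H v"
    and "\<And>T. T \<subseteq> verts G - {a} \<Longrightarrow> \<nu> T = \<mu> T"
  shows "partial_bracket d G a \<nu> = partial_bracket d H b \<mu>"
proof -
  have "(\<Prod>v\<in>verts H - {b} - T. alpha G v) * (\<Prod>t\<in>T. beta G t) * d ^ \<nu> T
      = (\<Prod>v\<in>verts H - {b} - T. alpha H v) * (\<Prod>t\<in>T. beta H t) * d ^ \<mu> T"
    if "T \<subseteq> verts H - {b}" for T
  proof -
    have "(\<Prod>v\<in>verts H - {b} - T. alpha G v) = (\<Prod>v\<in>verts H - {b} - T. alpha H v)"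
      using assms(1,3) by (intro prod.cong) auto
    moreover have "(\<Prod>t\<in>T. beta G t) = (\<Prod>t\<in>T. beta H t)"
      using assms(1,4) that by (intro prod.cong) auto
    ultimately show ?thesis
      using assms(1,5) that by simp
  qed
  then have "(\<Sum>T\<in>Pow (verts H - {b}).
        (\<Prod>v\<in>verts H - {b} - T. alpha G v) * (\<Prod>t\<in>T. beta G t) * d ^ \<nu> T)
    = (\<Sum>T\<in>Pow (verts H - {b}).
        (\<Prod>v\<in>verts H - {b} - T. alpha H v) * (\<Prod>t\<in>T. beta H t) * d ^ \<mu> T)"
    by (intro sum.cong) auto
  then show ?thesis
    unfolding partial_bracket_def assms(1,2) by (rule arg_cong)
qed

lemma bracket_eq_partial_bracket:
  assumes "a \<notin> verts G"
  shows "bracket d G = partial_bracket d G a (nullity_at G)"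
  using assms by (simp add: bracket_def partial_bracket_def nullity_at_def)

text \<open>Every vertex set either avoids \<open>a\<close> or arises uniquely by inserting
  \<open>a\<close> into a set that avoids it; a weight of \<open>a\<close> factors out of each half
  of the sum.\<close>

lemma bracket_split:
  assumes "finite (verts G)" and "a \<in> verts G"
  shows "bracket d G =
    alpha G a * partial_bracket d G a (nullity_at G)
    + beta G a * partial_bracket d G a (\<lambda>T. nullity_at G (insert a T))"
proof -
  let ?V = "verts G - {a}"
  let ?f = "\<lambda>T. (\<Prod>v\<in>verts G - T. alpha G v) * (\<Prod>t\<in>T. beta G t) * d ^ nullity_at G T"
  let ?w = "\<lambda>T. (\<Prod>v\<in>?V - T. alpha G v) * (\<Prod>t\<in>T. beta G t)"
  have V: "finite ?V" "verts G = insert a ?V"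
    using assms by auto
  have "Pow (verts G) = Pow ?V \<union> insert a ` Pow ?V"
    by (subst V(2)) (rule Pow_insert)
  moreover have "inj_on (insert a) (Pow ?V)"
    by (auto simp: inj_on_def)
  ultimately have "sum ?f (Pow (verts G)) = sum ?f (Pow ?V) + (\<Sum>T\<in>Pow ?V. ?f (insert a T))"
    using V(1) by (subst \<open>Pow (verts G) = _\<close>, subst sum.union_disjoint)
      (auto simp: sum.reindex)
  also have "sum ?f (Pow ?V) = alpha G a * (\<Sum>T\<in>Pow ?V. ?w T * d ^ nullity_at G T)"
    unfolding sum_distrib_left
  proof (intro sum.cong refl)
    fix T assume "T \<in> Pow ?V"
    then have "verts G - T = insert a (?V - T)"
      using assms(2) by auto
    then show "?f T = alpha G a * (?w T * d ^ nullity_at G T)"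
      using V(1) by (simp add: mult.assoc)
  qed
  also have "(\<Sum>T\<in>Pow ?V. ?f (insert a T))
      = beta G a * (\<Sum>T\<in>Pow ?V. ?w T * d ^ nullity_at G (insert a T))"
    unfolding sum_distrib_left
  proof (intro sum.cong refl)
    fix T assume T: "T \<in> Pow ?V"
    then have "finite T" "a \<notin> T"
      using V(1) finite_subset by auto
    moreover have "verts G - insert a T = ?V - T"
      by auto
    ultimately show "?f (insert a T) = beta G a * (?w T * d ^ nullity_at G (insert a T))"
      by (simp add: mult_ac)
  qed
  finally show ?thesis
    by (simp add: bracket_def partial_bracket_def nullity_at_def algebra_simps)
qed

section \<open>Reweighting and marking a vertex\<close>

lemma toggled_matrix_cong:
  assumes "edges G = edges H"
  shows "toggled_matrix G = toggled_matrix H"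
  using assms by (simp add: toggled_matrix_def[abs_def] adj_matrix_def looped_def adjacent_def
      fun_eq_iff)

lemma toggled_matrix_reweight: "toggled_matrix (reweight a x y G) = toggled_matrix G"
  by (rule toggled_matrix_cong) (simp add: reweight_def)

lemma surviving_reweight: "surviving (reweight a x y G) = surviving G"
  by (simp add: surviving_def[abs_def] toggled_matrix_reweight) (simp add: reweight_def)

lemma nullity_at_reweight: "nullity_at (reweight a x y G) = nullity_at G"
  by (simp add: nullity_at_def[abs_def] toggled_matrix_reweight surviving_reweight)

text \<open>An unlooped \<open>a\<close> outside \<open>T\<close> has diagonal entry 0, so marking
  it deletes its row and column.\<close>

lemma nullity_at_mark:
  assumes "\<not> looped G a" and "a \<notin> T"
  shows "nullity_at (mark a G) T = nullity_on (surviving G T - {a}) (toggled_matrix G T)"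
proof -
  have tog: "toggled_matrix (mark a G) = toggled_matrix G"
    by (rule toggled_matrix_cong) (simp add: mark_def)
  have "toggled_matrix G T a a = 0"
    using assms by (simp add: toggled_matrix_def adj_matrix_def)
  then have "surviving (mark a G) T = surviving G T - {a}"
    unfolding surviving_def tog by (auto simp: mark_def)
  then show ?thesis
    by (simp add: nullity_at_def tog)
qed

text \<open>This makes the right-hand side of the universality equation linear in the three weights.
  In the marked graph the second weight of \<open>a\<close> is 0, so only sets avoiding
  \<open>a\<close> contribute, and for these the mark deletes \<open>a\<close> from the
  matrix.\<close>

lemma bracket_reweight_add_mark:
  assumes "finite (verts G)" and "a \<in> verts G" and "\<not> looped G a"
  shows "bracket d (reweight a x y G) + bracket d (mark a (reweight a z 0 G)) =
    x * partial_bracket d G a (nullity_at G)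
    + y * partial_bracket d G a (\<lambda>T. nullity_at G (insert a T))
    + z * partial_bracket d G a
        (\<lambda>T. nullity_on (surviving G T - {a}) (toggled_matrix G T))"
proof -
  have nl: "\<not> looped (reweight a z 0 G) a"
    using assms(3) by (simp add: looped_def reweight_def)
  have "partial_bracket d (mark a (reweight a z 0 G)) a (nullity_at (mark a (reweight a z 0 G)))
     = partial_bracket d G a (\<lambda>T. nullity_on (surviving G T - {a}) (toggled_matrix G T))"
  proof (rule partial_bracket_cong)
    fix T assume "T \<subseteq> verts (mark a (reweight a z 0 G)) - {a}"
    then have "a \<notin> T" by auto
    then show "nullity_at (mark a (reweight a z 0 G)) T
        = nullity_on (surviving G T - {a}) (toggled_matrix G T)"
      using nl by (simp add: nullity_at_mark surviving_reweight toggled_matrix_reweight)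
  qed (auto simp: mark_def reweight_def)
  then have m: "bracket d (mark a (reweight a z 0 G)) = z * partial_bracket d G a
        (\<lambda>T. nullity_on (surviving G T - {a}) (toggled_matrix G T))"
    using assms bracket_split[of "mark a (reweight a z 0 G)" a d]
    by (simp add: mark_def reweight_def)
  have "partial_bracket d (reweight a x y G) a \<nu> = partial_bracket d G a \<nu>" for \<nu>
    by (rule partial_bracket_cong) (auto simp: reweight_def)
  then have "bracket d (reweight a x y G) = x * partial_bracket d G a (nullity_at G)
    + y * partial_bracket d G a (\<lambda>T. nullity_at G (insert a T))"
    using assms bracket_split[of "reweight a x y G" a d]
    by (simp add: nullity_at_reweight) (simp add: reweight_def)
  with m show ?thesis
    by simp
qed

section \<open>Composition with a vertex and with an edge\<close>

lemma composition_simps [simp]: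
  "verts (composition a F H) = (verts F \<union> verts H) - {a}"
  "floops (composition a F H) = floops F \<union> floops H"
  "marked (composition a F H) = (marked F \<union> marked H) - {a}"
  "alpha (composition a F H) v = (if v \<in> verts F then alpha F v else alpha H v)"
  "beta (composition a F H) v = (if v \<in> verts F then beta F v else beta H v)"
  by (simp_all add: composition_def)

lemma edges_composition:
  "edges (composition a F H) =
    filter_mset (\<lambda>e. a \<notin> set_uprod e) (edges F) + filter_mset (\<lambda>e. a \<notin> set_uprod e) (edges H)
    + mset_set {Upair v w | v w. Upair v a \<in># edges F \<and> Upair a w \<in># edges H}"
  by (simp add: composition_def del_vertex_def)

definition vertex_graph :: "'r \<Rightarrow> 'r \<Rightarrow> 'v \<Rightarrow> ('v, 'l, 'r) mwgraph" where
  "vertex_graph A B a =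
     \<lparr>verts = {a}, edges = {#}, floops = {}, marked = {}, alpha = \<lambda>_. A, beta = \<lambda>_. B\<rparr>"

text \<open>Vertex \<open>a\<close> carries the standard weights that a composition requires, while
  \<open>p\<close> and \<open>q\<close> at \<open>b\<close> stay free to serve as
  coefficients.\<close>

definition edge_graph ::
  "'r \<Rightarrow> 'r \<Rightarrow> 'v \<Rightarrow> 'r \<Rightarrow> 'r \<Rightarrow> 'v \<Rightarrow> ('v, 'l, 'r) mwgraph" where
  "edge_graph A B a p q b =
     \<lparr>verts = {a, b}, edges = {#Upair a b#}, floops = {}, marked = {},
      alpha = (\<lambda>_. p)(a := A), beta = (\<lambda>_. q)(a := B)\<rparr>"

lemma vertex_graph_simps [simp]:
  "verts (vertex_graph A B a) = {a}" "edges (vertex_graph A B a) = {#}"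
  "floops (vertex_graph A B a) = {}" "marked (vertex_graph A B a) = {}"
  by (simp_all add: vertex_graph_def)

lemma edge_graph_simps [simp]:
  "verts (edge_graph A B a p q b) = {a, b}" "edges (edge_graph A B a p q b) = {#Upair a b#}"
  "floops (edge_graph A B a p q b) = {}" "marked (edge_graph A B a p q b) = {}"
  "alpha (edge_graph A B a p q b) = (\<lambda>_. p)(a := A)"
  "beta (edge_graph A B a p q b) = (\<lambda>_. q)(a := B)"
  by (simp_all add: edge_graph_def)

text \<open>An isolated \<open>a\<close> contributes no joining edge, so the composition is
  \<open>H\<close> with \<open>a\<close> and its edges removed.\<close>

lemma bracket_composition_vertex:
  "bracket d (composition a H (vertex_graph A B a)) =
    partial_bracket d H a (\<lambda>T. nullity_on (surviving H T - {a}) (toggled_matrix H T))"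
proof -
  let ?C = "composition a H (vertex_graph A B a)"
  have edges: "edges ?C = filter_mset (\<lambda>e. a \<notin> set_uprod e) (edges H)"
    by (simp add: edges_composition)
  \<comment> \<open>The agreement is restricted to entries away from \<open>a\<close>, because
    \<open>H\<close> may have edges at \<open>a\<close> and the composition has none.\<close>
  have tog: "toggled_matrix ?C T v w = toggled_matrix H T v w" if "v \<noteq> a" "w \<noteq> a" for T v w
  proof -
    have "Upair v w \<in># edges ?C \<longleftrightarrow> Upair v w \<in># edges H"
      "Upair v v \<in># edges ?C \<longleftrightarrow> Upair v v \<in># edges H"
      using that by (simp_all add: edges)
    then show ?thesis
      by (simp only: toggled_matrix_def adj_matrix_def looped_def adjacent_def)
  qed
  have surv: "surviving ?C T = surviving H T - {a}" for T
  proof (rule set_eqI)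
    show "v \<in> surviving ?C T \<longleftrightarrow> v \<in> surviving H T - {a}" for v
      by (cases "v = a") (simp_all add: surviving_def tog)
  qed
  have "bracket d ?C = partial_bracket d ?C a (nullity_at ?C)"
    by (rule bracket_eq_partial_bracket) simp
  also have "\<dots> = partial_bracket d H a
      (\<lambda>T. nullity_on (surviving H T - {a}) (toggled_matrix H T))"
  proof (rule partial_bracket_cong)
    show "nullity_at ?C T = nullity_on (surviving H T - {a}) (toggled_matrix H T)" for T
      unfolding nullity_at_def surv by (intro nullity_on_cong tog) auto
  qed auto
  finally show ?thesis .
qed

text \<open>The joining edges connect \<open>b\<close> to exactly the former neighbors of
  \<open>a\<close>. Up to edge multiplicities, which the matrix ignores, the composition is
  \<open>H\<close> with \<open>a\<close> renamed to \<open>b\<close>, and its bracket is split at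
  \<open>b\<close>.\<close>

lemma bracket_composition_edge:
  assumes "wf_graph H" and "a \<in> verts H" and "\<not> looped H a" and "a \<notin> marked H"
    and "b \<notin> verts H"
  shows "bracket d (composition a H (edge_graph A B a p q b)) =
    p * partial_bracket d H a (nullity_at H)
    + q * partial_bracket d H a (\<lambda>T. nullity_at H (insert a T))"
proof -
  let ?C = "composition a H (edge_graph A B a p q b)"
  \<comment> \<open>A transposition is a bijection of the whole type, as
    \<open>nullity_on_rename\<close> demands; since \<open>b\<close> is not in \<open>H\<close>, it
    moves no vertex of \<open>H\<close> but \<open>a\<close>.\<close>
  let ?f = "transpose a b"
  have ab: "a \<noteq> b"
    using assms by auto
  have sub: "\<And>e v. e \<in># edges H \<Longrightarrow> v \<in> set_uprod e \<Longrightarrow> v \<in> verts H"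
    using assms(1) by (auto simp: wf_graph_def)
  have noaa: "Upair a a \<notin># edges H"
    using assms(3) by (simp add: looped_def)
  have nob: "Upair v b \<notin># edges H" "Upair b v \<notin># edges H" for v
    using sub[of "Upair v b" b] sub[of "Upair b v" b] assms(5) by auto
  let ?E = "{Upair v w | v w. Upair v a \<in># edges H \<and> Upair a w \<in># {#Upair a b#}}"
  have E: "?E = (\<lambda>v. Upair v b) ` {v. Upair v a \<in># edges H}"
    using ab by (auto simp: image_iff)
  \<comment> \<open>\<open>mset_set\<close> of an infinite set is empty, so finiteness is what lets
    membership in \<open>?E\<close> be read off the edge multiset.\<close>
  have "{v. Upair v a \<in># edges H} \<subseteq> verts H"
    using sub by force
  then have finE: "finite ?E"
    unfolding E using assms(1) by (meson finite_imageI finite_subset wf_graph_def)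
  have C: "verts ?C = insert b (verts H - {a})" "marked ?C = marked H"
    using ab assms(4) by auto
  have edges: "e \<in># edges ?C \<longleftrightarrow> e \<in># edges H \<and> a \<notin> set_uprod e
      \<or> (\<exists>v. Upair v a \<in># edges H \<and> e = Upair v b)" for e
  proof -
    have "e \<in># edges ?C \<longleftrightarrow> e \<in># edges H \<and> a \<notin> set_uprod e \<or> e \<in> ?E"
      unfolding edges_composition using finE by simp
    then show ?thesis
      unfolding E by blast
  qed
  \<comment> \<open>The delicate case is \<open>v = w = a\<close>: a loop at \<open>b\<close> would
    have to come from an edge of \<open>H\<close> between \<open>a\<close> and \<open>b\<close>, and
    there is none, just as \<open>a\<close> has no loop in \<open>H\<close>.\<close>
  have edges_f: "Upair (?f v) (?f w) \<in># edges ?C \<longleftrightarrow> Upair v w \<in># edges H"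
    if "v \<in> verts H" "w \<in> verts H" for v w
  proof -
    have "v \<noteq> b" "w \<noteq> b"
      using that assms(5) by auto
    then show ?thesis
      using ab noaa nob by (auto simp: edges transpose_def) (metis Upair_inject)+
  qed
  have tog: "toggled_matrix ?C (?f ` T) (?f v) (?f w) = toggled_matrix H T v w"
    if "v \<in> verts H" "w \<in> verts H" for T v w
  proof -
    have "?f v = ?f w \<longleftrightarrow> v = w" "?f v \<in> ?f ` T \<longleftrightarrow> v \<in> T"
      by (simp_all add: inj_image_mem_iff inj_eq)
    then show ?thesis
      using that edges_f[of v w] edges_f[of v v]
      by (simp only: toggled_matrix_def adj_matrix_def looped_def adjacent_def)
  qed
  have V: "verts ?C = ?f ` verts H"
  proof -
    have rest: "?f ` (verts H - {a}) = verts H - {a}"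
      using assms(5) by (force simp: transpose_def)
    have "?f ` verts H = ?f ` insert a (verts H - {a})"
      using assms(2) by (simp add: insert_absorb)
    also have "\<dots> = verts ?C"
      by (simp only: image_insert rest C(1) transpose_apply_first)
    finally show ?thesis
      by (rule sym)
  qed
  have mk: "?f v \<in> marked ?C \<longleftrightarrow> v \<in> marked H" if "v \<in> verts H" for v
    using that assms by (auto simp: C transpose_def wf_graph_def)
  have surv: "surviving ?C (?f ` T) = ?f ` surviving H T" for T
  proof -
    have "surviving ?C (?f ` T)
        = ?f ` {v \<in> verts H. \<not> (?f v \<in> marked ?C \<and> toggled_matrix ?C (?f ` T) (?f v) (?f v) = 0)}"
      unfolding surviving_def V by blast
    also have "\<dots> = ?f ` surviving H T"
      by (simp only: surviving_def tog mk cong: conj_cong)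
    finally show ?thesis .
  qed
  have nul: "nullity_at ?C (?f ` T) = nullity_at H T" for T
    unfolding nullity_at_def surv
    by (rule nullity_on_rename) (auto simp: surviving_def tog)
  \<comment> \<open>A set of vertices of the composition contains no \<open>a\<close>; if it also
    avoids \<open>b\<close>, the swap fixes it, so both partial brackets are sums over the same
    sets.\<close>
  have fix_T: "?f ` T = T" if "T \<subseteq> verts ?C - {b}" for T
  proof -
    have "?f v = v" if "v \<in> T" for v
      using that \<open>T \<subseteq> _\<close> assms(5) C(1) by (auto simp: transpose_def)
    then show ?thesis
      by simp
  qed
  have "partial_bracket d ?C b (nullity_at ?C) = partial_bracket d H a (nullity_at H)"
  proof (rule partial_bracket_cong)
    fix T assume "T \<subseteq> verts ?C - {b}"
    then show "nullity_at ?C T = nullity_at H T"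
      using nul[of T] fix_T by simp
  qed (use assms(5) in auto)
  moreover have "partial_bracket d ?C b (\<lambda>T. nullity_at ?C (insert b T))
      = partial_bracket d H a (\<lambda>T. nullity_at H (insert a T))"
  proof (rule partial_bracket_cong)
    fix T assume "T \<subseteq> verts ?C - {b}"
    then show "nullity_at ?C (insert b T) = nullity_at H (insert a T)"
      using nul[of "insert a T"] fix_T[of T] by simp
  qed (use assms(5) in auto)
  moreover have "alpha ?C b = p" "beta ?C b = q"
    using assms(5) ab by auto
  moreover have "finite (verts ?C)" "b \<in> verts ?C"
    using assms(1) ab by (auto simp: wf_graph_def)
  ultimately show ?thesis
    using bracket_split[of ?C b d] by simp
qed

section \<open>Reweighted and marked test graphs\<close>

lemma bracket_vertex_graph:
  fixes L :: "('v, 'l, 'r::comm_ring_1) mwgraph"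
  assumes L: "L = vertex_graph A B a"
  shows "bracket d (reweight a x y L) + bracket d (mark a (reweight a z 0 L)) = x * d + y + z"
proof -
  have "surviving L T = {a}" for T
    by (auto simp: surviving_def L)
  moreover have "toggled_matrix L T a a = of_bool (a \<in> T)" for T
    by (simp add: toggled_matrix_def adj_matrix_def looped_def L)
  \<comment> \<open>With \<open>a\<close> set aside no vertex is left, so only the empty set
    contributes.\<close>
  moreover have "partial_bracket d L a \<nu> = d ^ \<nu> {}" for \<nu>
    by (simp add: partial_bracket_def L)
  moreover have "finite (verts L)" "a \<in> verts L" "\<not> looped L a"
    by (auto simp: looped_def L)
  ultimately show ?thesis
    by (simp add: bracket_reweight_add_mark nullity_at_def nullity_on_singleton
        nullity_on_empty)
qed

text \<open>With \<open>a\<close> unmarked, the nullity is 1 only when \<open>T\<close> contains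
  both vertices. With \<open>a\<close> marked and outside \<open>T\<close>, only the row of
  \<open>b\<close> is left, and the nullity is 1 exactly when \<open>b\<close> is not in
  \<open>T\<close>.\<close>

lemma bracket_edge_graph:
  fixes L :: "('v, 'l, 'r::comm_ring_1) mwgraph"
  assumes "a \<noteq> b" and L: "L = edge_graph A B a p q b"
  shows "bracket d (reweight a x y L) + bracket d (mark a (reweight a z 0 L))
    = p * (x + y + z * d) + q * (x + y * d + z)"
proof -
  have S: "surviving L T = {a, b}" for T
    by (auto simp: surviving_def L)
  have M: "toggled_matrix L T a a = of_bool (a \<in> T)" "toggled_matrix L T b b = of_bool (b \<in> T)"
    "toggled_matrix L T a b = 1" "toggled_matrix L T b a = 1" for T
    using assms by (auto simp: toggled_matrix_def adj_matrix_def looped_def adjacent_def L)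
  have V: "verts L - {a} = {b}" "{a, b} - {a} = {b}"
    using assms by auto
  have pw: "Pow {b} = {{}, {b}}"
    by auto
  have "partial_bracket d L a \<nu> = p * d ^ \<nu> {} + q * d ^ \<nu> {b}" for \<nu>
    using assms by (simp add: partial_bracket_def V pw)
  moreover have "nullity_at L T = (if a \<in> T \<and> b \<in> T then 1 else 0)" for T
    using assms(1) by (simp add: nullity_at_def S nullity_on_pair M)
  moreover have "nullity_on (surviving L T - {a}) (toggled_matrix L T)
      = (if b \<in> T then 0 else 1)" for T
    by (simp add: S V nullity_on_singleton M)
  moreover have "finite (verts L)" "a \<in> verts L" "\<not> looped L a"
    using assms by (auto simp: looped_def L)
  ultimately show ?thesis
    using assms(1) by (simp add: bracket_reweight_add_mark algebra_simps)
qed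

section \<open>From test compositions to partial brackets\<close>

lemma composable_vertex_graph:
  assumes "wf_graph H" and "standard_vertex A B H a"
  shows "composable A B H (vertex_graph A B a) a"
  using assms by (auto simp: composable_def standard_vertex_def wf_graph_def vertex_graph_def
      looped_def)

lemma composable_edge_graph:
  assumes "wf_graph H" and "standard_vertex A B H a" and "b \<notin> verts H"
  shows "composable A B H (edge_graph A B a p q b) a"
  using assms by (auto simp: composable_def standard_vertex_def wf_graph_def edge_graph_def
      looped_def)

text \<open>The test graphs have no marked vertex, so universality applies to them. Each composition
  is then evaluated twice, once through partial brackets of \<open>H\<close> and once through the
  weights; comparing the results gives the three values.\<close>

lemma universal_weights_partial_brackets:
  fixes A B d :: "'r::comm_ring_1"
    and H :: "('v::infinite, 'l::infinite, 'r) mwgraph"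
  assumes "universal_weights A B d H a x y z"
  shows "partial_bracket d H a (nullity_at H) = x + y + z * d" (is ?without)
    and "partial_bracket d H a (\<lambda>T. nullity_at H (insert a T)) = x + y * d + z" (is ?with)
    and "partial_bracket d H a (\<lambda>T. nullity_on (surviving H T - {a}) (toggled_matrix H T))
      = x * d + y + z" (is ?deleted)
proof -
  have wf: "wf_graph H" and st: "standard_vertex A B H a"
    and univ: "\<And>L. composable A B H L a \<Longrightarrow> no_marked_nbr L a \<Longrightarrow>
        bracket d (composition a H L) =
          bracket d (reweight a x y L) + bracket d (mark a (reweight a z 0 L))"
    using assms by (auto simp: universal_weights_def)
  \<comment> \<open>A fresh vertex exists because \<open>H\<close> is finite and the vertex type is
    infinite.\<close>
  obtain b where b: "b \<notin> verts H"
    using wf ex_new_if_finite[OF infinite_UNIV, of "verts H"] unfolding wf_graph_def by blast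
  have a: "a \<in> verts H" "\<not> looped H a" "a \<notin> marked H"
    using st by (auto simp: standard_vertex_def)
  with b have ab: "a \<noteq> b"
    by auto
  have "p * partial_bracket d H a (nullity_at H)
      + q * partial_bracket d H a (\<lambda>T. nullity_at H (insert a T))
      = p * (x + y + z * d) + q * (x + y * d + z)" for p q
    using univ[OF composable_edge_graph[OF wf st b, of p q]]
    by (simp add: no_marked_nbr_def bracket_composition_edge[OF wf a b] bracket_edge_graph[OF ab])
  \<comment> \<open>The identity holds for all weights of \<open>b\<close>, so unit weights read off
    the coefficients of \<open>p\<close> and \<open>q\<close>.\<close>
  from this[of 1 0] this[of 0 1] show ?without ?with
    by simp_all
  show ?deleted
    using univ[OF composable_vertex_graph[OF wf st]]
    by (simp add: no_marked_nbr_def bracket_composition_vertex bracket_vertex_graph)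
qed

theorem corollary8:
  fixes A B d :: "'r::comm_ring_1"
    and F H :: "('v::infinite, 'l::infinite, 'r) mwgraph"
    and a :: 'v
    and \<alpha>F \<beta>F \<alpha>mF \<alpha>H \<beta>H \<alpha>mH :: 'r
  assumes "\<forall>x. d * x = 0 \<longrightarrow> x = 0"
    and "\<forall>x. (2 - d - d\<^sup>2) * x = 0 \<longrightarrow> x = 0"
    and "composable A B F H a"
    and "universal_weights A B d F a \<alpha>F \<beta>F \<alpha>mF"
    and "universal_weights A B d H a \<alpha>H \<beta>H \<alpha>mH"
    and "no_marked_nbr F a"
    and "no_marked_nbr H a"
  shows "bracket d (composition a F H) =
      \<alpha>F * (\<alpha>H + \<beta>H) + \<beta>F * (\<alpha>H + \<beta>H * d)
      + (\<alpha>F * d + \<beta>F) * \<alpha>mH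
      + \<alpha>mF * (\<alpha>H * d + \<beta>H) + \<alpha>mF * \<alpha>mH"
proof -
  have H: "finite (verts H)" "a \<in> verts H" "\<not> looped H a"
    using assms(3) by (auto simp: composable_def standard_vertex_def wf_graph_def)
  \<comment> \<open>\<open>H\<close> itself is an admissible \<open>L\<close> for
    \<open>(F, a)\<close>, since no neighbor of \<open>a\<close> in \<open>H\<close> is
    marked.\<close>
  have "bracket d (composition a F H) =
      bracket d (reweight a \<alpha>F \<beta>F H) + bracket d (mark a (reweight a \<alpha>mF 0 H))"
    using assms(3,4,7) by (simp add: universal_weights_def)
  \<comment> \<open>The three parentheses are the partial brackets of \<open>H\<close> for sets
    without \<open>a\<close>, for sets with \<open>a\<close>, and for \<open>a\<close>
    deleted.\<close>
  also have "\<dots> = \<alpha>F * (\<alpha>H + \<beta>H + \<alpha>mH * d) + \<beta>F * (\<alpha>H + \<beta>H * d + \<alpha>mH)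
      + \<alpha>mF * (\<alpha>H * d + \<beta>H + \<alpha>mH)"
    using H universal_weights_partial_brackets[OF assms(5)]
    by (simp add: bracket_reweight_add_mark)
  finally show ?thesis
    by (simp add: algebra_simps)
qed

end
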